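(* For large integer values of $b$, we have $$c_0\left(\frac{1}{b}\right)=\frac{1}{\pi}\,b\log b-\frac{b}{\pi}(\log 2\pi-\gamma)+O(1),$$ where $\gamma$ is the Euler-Mascheroni constant.
   Context: For integers $k\ge 2$ and $1\le h<k$ with $(h,k)=1$, the cotangent sum $c_0$ is defined by $$c_0\left(\frac{h}{k}\right)=-\sum_{m=1}^{k-1}\frac{m}{k}\cot\left(\frac{\pi mh}{k}\right),$$ so that $c_0(1/b)=-\sum_{m=1}^{b-1}\frac{m}{b}\cot\left(\frac{\pi m}{b}\right)$. Here $\log$ is the natural logarithm, $\log 2\pi$ means $\log(2\pi)$, and the implied constant in $O(1)$ is absolute (as $b\to\infty$ through the integers). *)

theory Defs
  imports "HOL-Analysis.Analysis" "HOL-Library.Landau_Symbols"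
begin

text \<open>
  The value of the cotangent sum at the reduced fraction \<open>h / k\<close>, as a function of numerator and
  denominator; it is meant for \<open>k \<ge> 2\<close>, \<open>1 \<le> h < k\<close> and \<open>coprime h k\<close>.
\<close>

definition c0 :: "nat \<Rightarrow> nat \<Rightarrow> real" where
  "c0 h k = - (\<Sum>m = 1..k - 1. real m / real k * cot (pi * real m * real h / real k))"

end

theory Submission
  imports Defs
begin

text \<open>
  Logarithmic differentiation of Euler's reflection formula turns the cotangent into a difference of
  digamma values, \<open>\<pi> cot (\<pi>x) = \<psi>(1 - x) - \<psi>(x)\<close>. The poles of \<open>\<psi>\<close> are then split off by
  \<open>\<psi>(1 + x) = \<psi>(x) + 1/x\<close>, and the substitution \<open>m \<mapsto> b - m\<close> moves what remains of the pole at
  \<open>x = 1\<close> to \<open>x = 0\<close>. The result is an exact formula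
  (\<open>pi_c0_one_eq_harm_plus_cot_remainder\<close>):
  \<open>\<pi> c0(1/b) = b H(b - 1) + \<Sum> \<phi>(m/b)\<close>, where \<open>m\<close> runs from 1 to \<open>b - 1\<close>, \<open>H\<close> denotes harmonic
  numbers and \<open>\<phi>(x) = (2x - 1) \<psi>(1 + x) - 2\<close>.

  The harmonic number produces \<open>b log b + b \<gamma>\<close> with a bounded error (\<open>harm_approx\<close>). The function
  \<open>\<phi>\<close> is Lipschitz on the unit interval, so its sum is \<open>b\<close> times its integral, again with a bounded
  error (\<open>Riemann_sum_Lipschitz\<close>). Integration by parts reduces the integral of \<open>\<phi>\<close> to that of
  \<open>log \<Gamma>\<close> over the interval from 1 to 2, which \<open>Raabe_formula\<close> evaluates; the boundary terms vanish
  and the integral of \<open>\<phi>\<close> equals \<open>- log (2\<pi>)\<close>, the remaining part of the main term.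
\<close>

section \<open>Reflection and duplication for the real Gamma function\<close>

lemma Gamma_reflection_real:
  fixes x :: real
  shows "Gamma x * Gamma (1 - x) = pi / sin (pi * x)"
proof -
  have "complex_of_real (Gamma x * Gamma (1 - x)) = complex_of_real (pi / sin (pi * x))"
    using Gamma_reflection_complex[of "complex_of_real x"]
    by (metis Gamma_complex_of_real of_real_1 of_real_diff of_real_divide of_real_mult sin_of_real)
  then show ?thesis
    by (simp only: of_real_eq_iff)
qed

text \<open>
  The two sides are, up to sign, the derivatives of both sides of
  \<open>log \<Gamma>(x) + log \<Gamma>(1 - x) = log \<pi> - log sin (\<pi>x)\<close>, which holds on the open unit interval, where
  all arguments of the logarithms are positive.
\<close>
lemma Digamma_reflection_real:
  fixes x :: real
  assumes "0 < x" "x < 1"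
  shows "Digamma (1 - x) - Digamma x = pi * cot (pi * x)"
proof -
  have sin_pos: "sin (pi * t) > 0" if "t \<in> {0<..<1}" for t :: real
    using that by (intro sin_gt_zero) auto
  have eq: "ln_Gamma t + ln_Gamma (1 - t) = ln pi - ln (sin (pi * t))"
    if t: "t \<in> {0<..<1}" for t :: real
  proof -
    have "ln_Gamma t + ln_Gamma (1 - t) = ln (Gamma t * Gamma (1 - t))"
      using t by (simp add: ln_Gamma_real_pos ln_mult_pos)
    then show ?thesis
      using sin_pos[OF t] by (simp add: Gamma_reflection_real ln_div)
  qed
  have "((\<lambda>t. ln pi - ln (sin (pi * t))) has_real_derivative - (pi * cot (pi * x))) (at x)"
    using sin_pos[of x] assms
    by (auto intro!: derivative_eq_intros simp: cot_def field_simps)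
  then have "((\<lambda>t. ln_Gamma t + ln_Gamma (1 - t)) has_real_derivative - (pi * cot (pi * x))) (at x)"
    by (rule has_field_derivative_transform_within_open[of _ _ _ "{0<..<1}"])
       (use assms eq in auto)
  moreover have "((\<lambda>t. ln_Gamma t + ln_Gamma (1 - t)) has_real_derivative
      Digamma x - Digamma (1 - x)) (at x)"
    using assms by (auto intro!: derivative_eq_intros)
  ultimately show ?thesis
    by (auto dest: DERIV_unique)
qed

lemma ln_Gamma_legendre_duplication_real:
  fixes z :: real
  assumes "z > 0"
  shows "ln_Gamma z + ln_Gamma (z + 1 / 2) = (1 - 2 * z) * ln 2 + ln pi / 2 + ln_Gamma (2 * z)"
proof -
  have notin: "complex_of_real t \<notin> \<int>\<^sub>\<le>\<^sub>0" if "t > 0" for t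
    using that nonpos_Ints_nonpos[of t] by (auto simp only: of_real_in_nonpos_Ints_iff)
  have complex_args: "complex_of_real z + 1 / 2 = complex_of_real (z + 1 / 2)"
    "2 * complex_of_real z = complex_of_real (2 * z)"
    "(1 - complex_of_real (2 * z)) * complex_of_real (ln 2) = complex_of_real ((1 - 2 * z) * ln 2)"
    by simp_all
  have "complex_of_real (Gamma z * Gamma (z + 1 / 2)) =
      complex_of_real (exp ((1 - 2 * z) * ln 2) * sqrt pi * Gamma (2 * z))"
    using Gamma_legendre_duplication[of "complex_of_real z"] notin[of z] notin[of "z + 1 / 2"] assms
    unfolding complex_args exp_of_real Gamma_complex_of_real by simp
  then have "Gamma z * Gamma (z + 1 / 2) = exp ((1 - 2 * z) * ln 2) * sqrt pi * Gamma (2 * z)"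
    by (simp only: of_real_eq_iff)
  then have "ln (Gamma z * Gamma (z + 1 / 2)) = ln (exp ((1 - 2 * z) * ln 2) * sqrt pi * Gamma (2 * z))"
    by (simp only:)
  moreover have "Gamma z > 0" "Gamma (z + 1 / 2) > 0" "Gamma (2 * z) > 0"
    using assms by auto
  ultimately show ?thesis
    using assms by (simp add: ln_Gamma_real_pos ln_mult_pos ln_sqrt)
qed

section \<open>Raabe's formula\<close>

lemma constant_on_greaterThan:
  fixes f :: "real \<Rightarrow> real"
  assumes "\<And>x. x > a \<Longrightarrow> (f has_real_derivative 0) (at x)" "x > a" "y > a"
  shows "f x = f y"
proof -
  have "\<exists>c. \<forall>x\<in>{a<..}. f x = c"
    by (rule has_field_derivative_zero_constant) (use assms(1) in \<open>auto simp: has_field_derivative_at_within\<close>)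
  then show ?thesis using assms(2,3) by auto
qed

text \<open>
  Let \<open>J\<close> be an antiderivative of \<open>log \<Gamma>\<close>. The functional equation of \<open>\<Gamma>\<close> shows that
  \<open>J(x + 1) - J(x)\<close> has derivative \<open>log x\<close>, hence equals \<open>x log x - x + C\<close>. Only \<open>C\<close> has to be found,
  and the duplication formula finds it without any asymptotics of \<open>\<Gamma>\<close>: it makes
  \<open>J(x) + J(x + 1/2) - J(2x)/2\<close> an explicit quadratic polynomial up to a constant. The increment of
  this expression from \<open>z\<close> to \<open>z + 1/2\<close> is therefore explicit, while the left-hand side gives
  \<open>(J(z + 1) - J(z)) - (J(2z + 1) - J(2z))/2\<close>, which is \<open>C/2 - z log 2\<close>.
\<close>
theorem Raabe_formula:
  fixes z :: real
  assumes "z > 0"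
  shows "(ln_Gamma has_integral (z * ln z - z + ln (2 * pi) / 2)) {z..z + 1}"
proof -
  \<comment> \<open>Base point of \<open>J\<close>: positive, to avoid the singularity of \<open>log \<Gamma>\<close>, and below \<open>z\<close>, so that \<open>z\<close> is interior.\<close>
  define a where "a = z / 2"
  have a: "0 < a" "a < z" using assms by (auto simp: a_def)
  define J where "J = (\<lambda>x. integral {a..x} ln_Gamma)"
  have cont: "continuous_on {u..v} (ln_Gamma :: real \<Rightarrow> real)" if "0 < u" for u v
    using that by (intro DERIV_continuous_on[where D = Digamma]
        has_field_derivative_at_within[OF has_field_derivative_ln_Gamma_real]) auto
  have J: "(J has_real_derivative ln_Gamma x) (at x)" if "x > a" for x
    using integral_has_real_derivative[OF cont[OF a(1)], of x "x + 1"] that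
      at_within_interior[of x "{a..x + 1}"] unfolding J_def by simp
  note J' = DERIV_chain2[OF J]
  define C where "C = J (z + 1) - J z - (z * ln z - z)"
  have shift: "J (x + 1) - J x = x * ln x - x + C" if "x > a" for x
  proof -
    have "((\<lambda>x. J (x + 1) - J x - (x * ln x - x)) has_real_derivative 0) (at x)" if "x > a" for x
    proof -
      have "ln_Gamma (x + 1) = ln x + ln_Gamma x"
      proof -
        have "x \<notin> \<int>\<^sub>\<le>\<^sub>0" using that a by (auto elim!: nonpos_Ints_cases)
        then show ?thesis
          using that a by (simp add: Gamma_plus1 ln_Gamma_real_pos ln_mult_pos)
      qed
      then show ?thesis
        using that a by (auto intro!: derivative_eq_intros J')
    qed
    from constant_on_greaterThan[OF this that a(2)] show ?thesis
      by (simp add: C_def)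
  qed
  define K where "K x = J x + J (x + 1 / 2) - J (2 * x) / 2 - ((x - x\<^sup>2) * ln 2 + x * (ln pi / 2))" for x
  have "(K has_real_derivative 0) (at x)" if "x > a" for x
    unfolding K_def using that a ln_Gamma_legendre_duplication_real[of x]
    by (auto intro!: derivative_eq_intros J' simp: field_simps)
  then have dup: "K (z + 1 / 2) = K z"
    by (rule constant_on_greaterThan) (use a in auto)
  have "C = ln (2 * pi) / 2"
    using dup[unfolded K_def] shift[of z] shift[of "2 * z"] a
    by (simp add: ln_mult_pos algebra_simps power2_eq_square)
  then have "J (z + 1) - J z = z * ln z - z + ln (2 * pi) / 2"
    using shift a by simp
  moreover have "(ln_Gamma has_integral (J (z + 1) - J z)) {z..z + 1}"
    by (intro fundamental_theorem_of_calculus)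
       (use a in \<open>auto intro!: has_field_derivative_at_within[OF J]
          simp flip: has_real_derivative_iff_has_vector_derivative\<close>)
  ultimately show ?thesis by simp
qed

section \<open>Riemann sums of Lipschitz functions\<close>

text \<open>
  On each of the \<open>b\<close> subintervals the mean value theorem replaces the increment of \<open>F\<close> by a value of
  \<open>f\<close> at a point within \<open>1/b\<close> of the left end. Each summand is thus off by at most \<open>L/b\<close>.
\<close>
lemma Riemann_sum_Lipschitz:
  fixes f F :: "real \<Rightarrow> real"
  assumes lip: "L-lipschitz_on {0..1} f"
    and F: "\<And>x. x \<in> {0..1} \<Longrightarrow> (F has_real_derivative f x) (at x)"
    and b: "b > 0"
  shows "\<bar>(\<Sum>m<b. f (real m / real b)) - real b * (F 1 - F 0)\<bar> \<le> L"
proof -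
  let ?x = "\<lambda>m. real m / real b"
  have step: "\<bar>f (?x m) - real b * (F (?x (Suc m)) - F (?x m))\<bar> \<le> L / real b" if "m < b" for m
  proof -
    have le: "?x m < ?x (Suc m)" "0 \<le> ?x m" "?x (Suc m) \<le> 1"
      using that b by (auto simp: field_simps)
    have "\<exists>y. ?x m < y \<and> y < ?x (Suc m) \<and> F (?x (Suc m)) - F (?x m) = (?x (Suc m) - ?x m) * f y"
      by (rule MVT2[OF le(1)], rule F) (unfold atLeastAtMost_iff, use le(2,3) in linarith)
    then obtain y where y: "?x m < y" "y < ?x (Suc m)"
      "F (?x (Suc m)) - F (?x m) = (?x (Suc m) - ?x m) * f y"
      by blast
    have diff: "?x (Suc m) - ?x m = 1 / real b"
      by (simp add: diff_divide_distrib[symmetric])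
    have "real b * (F (?x (Suc m)) - F (?x m)) = f y"
      unfolding y(3) diff using b by simp
    moreover have "\<bar>f (?x m) - f y\<bar> \<le> L * \<bar>?x m - y\<bar>"
      using lipschitz_onD[OF lip, of "?x m" y] y le by (simp add: dist_real_def)
    moreover have "L * \<bar>?x m - y\<bar> \<le> L * (1 / real b)"
      using y diff lipschitz_on_nonneg[OF lip] by (intro mult_left_mono) linarith+
    ultimately show ?thesis by simp
  qed
  have "(\<Sum>m<b. F (?x (Suc m)) - F (?x m)) = F 1 - F 0"
    using sum_lessThan_telescope[of "\<lambda>m. F (?x m)" b] b by simp
  then have "(\<Sum>m<b. f (?x m)) - real b * (F 1 - F 0)
      = (\<Sum>m<b. f (?x m) - real b * (F (?x (Suc m)) - F (?x m)))"
    by (simp only: sum_subtractf sum_distrib_left[symmetric])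
  also have "\<bar>\<dots>\<bar> \<le> (\<Sum>m<b. L / real b)"
    by (intro order.trans[OF sum_abs] sum_mono step) auto
  also have "\<dots> = L" using b by simp
  finally show ?thesis .
qed

section \<open>The cotangent sum\<close>

text \<open>
  This is \<open>\<pi> (1 - 2x) cot (\<pi>x) / 2\<close> without its poles \<open>1 / (2x)\<close> and \<open>1 / (2 (1 - x))\<close>, after
  replacing \<open>\<psi>(2 - x)\<close> by \<open>\<psi>(1 + x)\<close> through the symmetry \<open>x \<mapsto> 1 - x\<close>, which preserves sums over the
  points \<open>m/b\<close> with \<open>0 < m < b\<close>.
\<close>
definition cot_remainder :: "real \<Rightarrow> real" where
  "cot_remainder x = (2 * x - 1) * Digamma (1 + x) - 2"

text \<open>
  By the reflection formula a summand \<open>-x \<pi> cot (\<pi>x)\<close> splits into a term in \<open>\<psi>(1 + x)\<close> and a term in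
  \<open>\<psi>(1 + (1 - x))\<close>. The second one, with its pole at \<open>x = 1\<close>, is a function \<open>g\<close> of \<open>1 - x\<close>;
  reversing the order of summation turns it into \<open>g(x)\<close>. The only pole left is \<open>1/x\<close>, which at
  \<open>x = m/b\<close> sums to the harmonic number.
\<close>
lemma pi_c0_one_eq_harm_plus_cot_remainder:
  assumes "b \<ge> 1"
  shows "pi * c0 1 b = real b * harm (b - 1) + (\<Sum>m = 1..b - 1. cot_remainder (real m / real b))"
proof -
  let ?x = "\<lambda>m. real m / real b"
  define g :: "real \<Rightarrow> real" where "g x = - (1 - x) * Digamma (1 + x) + (1 - x) / x" for x
  have x: "?x m > 0" "?x m < 1" "1 - ?x m = ?x (b - m)" if "m \<in> {1..b - 1}" for m
    using that by (auto simp: of_nat_diff field_simps)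
  have summand: "- (x * (pi * cot (pi * x))) = g (1 - x) + (x * Digamma (1 + x) - 1)"
    if "0 < x" "x < 1" for x :: real
  proof -
    have *: "Digamma (1 + x) = Digamma x + 1 / x"
      using Digamma_plus1[of x] that by (simp add: add.commute)
    have **: "Digamma (1 + (1 - x)) = Digamma (1 - x) + 1 / (1 - x)"
      using Digamma_plus1[of "1 - x"] that by (subst add.commute) linarith
    show ?thesis
      unfolding g_def * ** Digamma_reflection_real[OF that, symmetric]
      using that by (simp add: divide_simps) (simp add: algebra_simps)
  qed
  have "pi * c0 1 b = (\<Sum>m = 1..b - 1. - (?x m * (pi * cot (pi * ?x m))))"
    by (simp add: c0_def sum_distrib_left sum_negf algebra_simps)
  also have "\<dots> = (\<Sum>m = 1..b - 1. g (?x (b - m))) + (\<Sum>m = 1..b - 1. ?x m * Digamma (1 + ?x m) - 1)"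
    unfolding sum.distrib[symmetric] by (intro sum.cong refl) (simp only: summand[OF x(1,2)] x(3))
  also have "(\<Sum>m = 1..b - 1. g (?x (b - m))) = (\<Sum>m = 1..b - 1. g (?x m))"
    by (rule sum.reindex_bij_witness[of _ "\<lambda>m. b - m" "\<lambda>m. b - m"]) auto
  also have "\<dots> + (\<Sum>m = 1..b - 1. ?x m * Digamma (1 + ?x m) - 1)
      = (\<Sum>m = 1..b - 1. real b * inverse (real m) + cot_remainder (?x m))"
    unfolding sum.distrib[symmetric]
  proof (intro sum.cong refl)
    fix m assume "m \<in> {1..b - 1}"
    then have "0 < m" "0 < b" by auto
    then have "g (?x m) + (?x m * Digamma (1 + ?x m) - 1) = 1 / ?x m + cot_remainder (?x m)"
      unfolding g_def cot_remainder_def by (simp add: field_simps)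
    then show "g (?x m) + (?x m * Digamma (1 + ?x m) - 1) = real b * inverse (real m) + cot_remainder (?x m)"
      by (simp add: divide_inverse)
  qed
  finally show ?thesis
    by (simp add: sum.distrib harm_def sum_distrib_left)
qed

lemma cot_remainder_Lipschitz: "\<exists>L. L-lipschitz_on {0..1} cot_remainder"
proof -
  define D :: "real \<Rightarrow> real" where "D x = 2 * Digamma (1 + x) + (2 * x - 1) * Polygamma 1 (1 + x)" for x
  have pos: "1 + x \<notin> \<int>\<^sub>\<le>\<^sub>0" if "x \<ge> 0" for x :: real
    using that by (auto elim!: nonpos_Ints_cases)
  have deriv: "(cot_remainder has_real_derivative D x) (at x within {0..1})" if "x \<in> {0..1}" for x
    unfolding cot_remainder_def D_def using that pos[of x]
    by (auto intro!: derivative_eq_intros)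
  have "continuous_on {0..1} D"
    unfolding D_def
    by (intro continuous_at_imp_continuous_on ballI continuous_intros) (auto intro: pos)
  then have "compact (D ` {0..1})"
    by (intro compact_continuous_image) auto
  then obtain L where "\<And>x. x \<in> {0..1} \<Longrightarrow> \<bar>D x\<bar> \<le> L" 
    by (metis bounded_iff compact_imp_bounded imageI real_norm_def)
  moreover from this[of 0] have "0 \<le> L" by simp
  ultimately have "L-lipschitz_on {0..1} cot_remainder"
    using deriv
    by (intro bounded_derivative_imp_lipschitz[where f' = "\<lambda>x h. D x * h"] onorm_le)
       (auto simp: has_field_derivative_def abs_mult intro: mult_right_mono)
  then show ?thesis ..
qed

text \<open>
  Integration by parts gives the antiderivative \<open>(2x - 1) log \<Gamma>(1 + x) - 2x - 2 J(1 + x)\<close>, where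
  \<open>J\<close> is an antiderivative of \<open>log \<Gamma>\<close>. Since \<open>\<Gamma>(1) = \<Gamma>(2) = 1\<close>, its total increment is
  \<open>-2 - 2 (J(2) - J(1))\<close>, and Raabe's formula at 1 gives \<open>J(2) - J(1) = log (2\<pi>)/2 - 1\<close>.
\<close>
lemma cot_remainder_antiderivative:
  "\<exists>F. (\<forall>x\<in>{0..1}. (F has_real_derivative cot_remainder x) (at x)) \<and> F 1 - F 0 = - ln (2 * pi)"
proof -
  \<comment> \<open>Starting at \<open>1/2\<close> puts 1 in the interior, so that \<open>J\<close> has a two-sided derivative there.\<close>
  define J where "J = (\<lambda>x. integral {1 / 2..x} (ln_Gamma :: real \<Rightarrow> real))"
  have cont: "continuous_on {1 / 2..3} (ln_Gamma :: real \<Rightarrow> real)"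
    by (intro DERIV_continuous_on[where D = Digamma]
        has_field_derivative_at_within[OF has_field_derivative_ln_Gamma_real]) auto
  have J: "(J has_real_derivative ln_Gamma x) (at x)" if "x \<in> {1..2}" for x
    using integral_has_real_derivative[OF cont, of x] that
      at_within_interior[of x "{1 / 2..3}"] unfolding J_def by simp
  have "(ln_Gamma has_integral (J 2 - J 1)) {1..2}"
    by (intro fundamental_theorem_of_calculus)
       (auto intro!: has_field_derivative_at_within[OF J]
          simp flip: has_real_derivative_iff_has_vector_derivative)
  moreover have "(ln_Gamma has_integral (- 1 + ln (2 * pi) / 2)) {1..2}"
    using Raabe_formula[of 1] by simp
  ultimately have J12: "J 2 - J 1 = - 1 + ln (2 * pi) / 2"
    by (rule has_integral_unique)
  define F where "F x = (2 * x - 1) * ln_Gamma (1 + x) - 2 * x - 2 * J (1 + x)" for x :: real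
  have "(F has_real_derivative cot_remainder x) (at x)" if "x \<in> {0..1}" for x
    unfolding F_def cot_remainder_def using that
    by (auto intro!: derivative_eq_intros DERIV_chain2[OF J] simp: algebra_simps)
  moreover have "ln_Gamma 1 = (0 :: real)" "ln_Gamma 2 = (0 :: real)"
    using ln_Gamma_real_conv_fact[of 1] ln_Gamma_real_conv_fact[of 2] by auto
  then have "F 1 - F 0 = - ln (2 * pi)"
    using J12 by (simp add: F_def)
  ultimately show ?thesis by blast
qed

text \<open>
  The known two-sided bounds compare the harmonic number of \<open>n - 1\<close> with \<open>ln n\<close>. Their error is at
  most \<open>1 / (2 (n - 1))\<close>, hence at most \<open>1/n\<close> once \<open>n \<ge> 2\<close>; for \<open>n = 1\<close> the claim is
  \<open>\<gamma> \<le> 1\<close>.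
\<close>
lemma harm_approx:
  assumes "n \<ge> 1"
  shows "real n * \<bar>harm (n - 1) - ln (real n) - euler_mascheroni\<bar> \<le> 1"
proof (cases "n = 1")
  case True
  then show ?thesis
    using euler_mascheroni_less_13_over_22 euler_mascheroni_pos by (simp add: harm_def)
next
  case False
  then have n: "n \<ge> 2" using assms by simp
  obtain k where k: "n = Suc k" "k \<ge> 1"
    using n by (cases n) auto
  let ?t = "harm (n - 1) - ln (real n)"
  have "?t + inverse (real (2 * (k + 1))) \<le> euler_mascheroni"
    "euler_mascheroni \<le> ?t + inverse (real (2 * k))"
    using euler_mascheroni_bounds[OF k(2)] unfolding k(1) diff_Suc_1 by (simp_all only: atLeastAtMost_iff)
  moreover have "inverse (real (2 * (k + 1))) \<ge> 0" by simp
  moreover have "inverse (real (2 * k)) \<le> 1 / real n"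
    using k by (simp add: field_simps)
  ultimately have "\<bar>?t - euler_mascheroni\<bar> \<le> 1 / real n"
    by linarith
  moreover have "real n > 0" using n by simp
  ultimately show ?thesis
    by (simp only: pos_le_divide_eq mult.commute[of _ "real n"])
qed

theorem theorem1p3:
  shows "(\<lambda>b::nat. c0 1 b -
            (1 / pi * real b * ln (real b) - real b / pi * (ln (2 * pi) - (euler_mascheroni :: real))))
         \<in> O(\<lambda>_. 1)"
proof -
  obtain L where L: "L-lipschitz_on {0..1} cot_remainder"
    using cot_remainder_Lipschitz by blast
  obtain F where F: "\<And>x. x \<in> {0..1} \<Longrightarrow> (F has_real_derivative cot_remainder x) (at x)"
    and F01: "F 1 - F 0 = - ln (2 * pi)"
    using cot_remainder_antiderivative by blast
  have "norm (c0 1 b - (1 / pi * real b * ln (real b) - real b / pi * (ln (2 * pi) - euler_mascheroni)))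
      \<le> ((1 + L + \<bar>cot_remainder 0\<bar>) / pi) * norm (1 :: real)" if b: "b \<ge> 1" for b :: nat
  proof -
    let ?S = "\<Sum>m = 1..b - 1. cot_remainder (real m / real b)"
    let ?h = "real b * (harm (b - 1) - ln (real b) - euler_mascheroni)"
    \<comment> \<open>The Riemann sum starts at \<open>m = 0\<close>; the extra summand \<open>cot_remainder 0\<close> is part of the bounded error.\<close>
    have "{..<b} = insert 0 {1..b - 1}"
      using b by auto
    then have S: "(\<Sum>m<b. cot_remainder (real m / real b)) = cot_remainder 0 + ?S"
      by simp
    let ?E = "c0 1 b - (1 / pi * real b * ln (real b) - real b / pi * (ln (2 * pi) - euler_mascheroni))"
    have "pi * ?E
        = pi * c0 1 b - real b * ln (real b) + real b * (ln (2 * pi) - euler_mascheroni)"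
      by (simp add: algebra_simps)
    also have "\<dots> = ?h + (cot_remainder 0 + ?S - real b * (F 1 - F 0)) - cot_remainder 0"
      unfolding pi_c0_one_eq_harm_plus_cot_remainder[OF b] F01 by (simp add: algebra_simps)
    also have "\<bar>\<dots>\<bar> \<le> 1 + L + \<bar>cot_remainder 0\<bar>"
    proof -
      have "\<bar>?h\<bar> \<le> 1"
        using harm_approx[OF b] by (simp add: abs_mult)
      moreover have "\<bar>cot_remainder 0 + ?S - real b * (F 1 - F 0)\<bar> \<le> L"
        using Riemann_sum_Lipschitz[OF L F, of b] b unfolding S by simp
      ultimately show ?thesis by linarith
    qed
    finally have "pi * \<bar>?E\<bar> \<le> 1 + L + \<bar>cot_remainder 0\<bar>"
      by (simp only: abs_mult abs_of_pos[OF pi_gt_zero])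
    then have "\<bar>?E\<bar> \<le> (1 + L + \<bar>cot_remainder 0\<bar>) / pi"
      by (simp only: pos_le_divide_eq[OF pi_gt_zero] mult.commute[of _ pi])
    then show ?thesis
      by (simp only: real_norm_def norm_one mult_1_right)
  qed
  then show ?thesis
    by (intro bigoI[of _ "(1 + L + \<bar>cot_remainder 0\<bar>) / pi"] eventually_sequentiallyI[of 1])
qed

end
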